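(* Let $n\ge1$, let $1\le J<2^n$, let $\mathcal{X}_p$ be the index set of $J$ punctured bits in $\mathbf{x}$ for a punctured polar code of length $M=2^n-J$, and let $\mathcal{U}_p$ be the index set of the incapable bits in $\mathbf{u}$ resulting from $\mathcal{X}_p$. Assume that $\mathcal{X}_p=\{p_{2^n-J},\ldots,p_{2^n-1}\}$ consists of the last $J$ entries of some $2^n$-posequence $(p_0,\ldots,p_{2^n-1})$ (so that $\mathcal{X}_p$ complies with binary domination). Then $\mathcal{X}_p$ is a reverse puncturing bit pattern, that is, $\mathcal{U}_p=\bar{\mathcal{X}}_p$, where $\bar{\mathcal{X}}_p=\{\bar{x}\mid x\in\mathcal{X}_p\}$.
   Context: Let $\mathbb{Z}_{2^n}=\{0,1,\ldots,2^n-1\}$ and write $i=\sum_{t=0}^{n-1}i_t2^t$ with $i_t\in\{0,1\}$. The bitwise complement of $i$ is $\bar{i}=(2^n-1)-i$. Binary domination: $i\preceq j$ iff $i_t\le j_t$ for all $t$; $i\prec j$ iff $i\preceq j$ and $i\ne j$. A $2^n$-posequence is a permutation $(p_0,\ldots,p_{2^n-1})$ of $\mathbb{Z}_{2^n}$ such that there is no pair $i<j$ with $p_j\prec p_i$. A set $\mathcal{A}\subseteq\mathbb{Z}_{2^n}$ complies with binary domination if either $\{k:k\preceq j\}\subseteq\mathcal{A}$ for all $j\in\mathcal{A}$, or $\{k:k\succeq j\}\subseteq\mathcal{A}$ for all $j\in\mathcal{A}$. Puncturing model. The polar code of length $2^n$ encodes $\mathbf{u}\in\mathbb{F}_2^{2^n}$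 to $\mathbf{x}=\mathbf{u}\left[\begin{smallmatrix}1&0\\1&1\end{smallmatrix}\right]^{\otimes n}$. A puncturing bit pattern is a set $\mathcal{X}_p\subseteq\mathbb{Z}_{2^n}$ of indices of encoder output bits that are not transmitted. Successive-cancellation (SC) decoding computes LLRs $\alpha_i^{(t)}$ for $i\in\mathbb{Z}_{2^n}$ and stages $t=n,n-1,\ldots,0$, whose zero pattern is governed by: $\alpha_i^{(n)}=0$ iff $i\in\mathcal{X}_p$; for $t<n$ and $i_t=0$, $\alpha_i^{(t)}=0$ iff at least one of $\alpha_i^{(t+1)},\alpha_{i+2^t}^{(t+1)}$ is zero; for $t<n$ and $i_t=1$, $\alpha_i^{(t)}=0$ iff both $\alpha_{i-2^t}^{(t+1)}$ and $\alpha_i^{(t+1)}$ are zero. The bit $u_j$ is incapable if $\alpha_j^{(0)}=0$, and $\mathcal{U}_p=\{j:\alpha_j^{(0)}=0\}$. *)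

theory Defs
  imports Complex_Main
begin

text \<open>Indices in \<open>\<int>\<^bsub>2^n\<^esub>\<close> are natural numbers below \<open>2 ^ n\<close>; the binary digit \<open>i\<^sub>t\<close> is
  \<open>bit i t\<close>.\<close>

definition bcompl :: "nat \<Rightarrow> nat \<Rightarrow> nat"
  where "bcompl n i = (2 ^ n - 1) - i"

definition bdom :: "nat \<Rightarrow> nat \<Rightarrow> nat \<Rightarrow> bool"
  where "bdom n i j \<longleftrightarrow> (\<forall>t<n. bit i t \<longrightarrow> bit j t)"

definition sbdom :: "nat \<Rightarrow> nat \<Rightarrow> nat \<Rightarrow> bool"
  where "sbdom n i j \<longleftrightarrow> bdom n i j \<and> i \<noteq> j"

definition posequence :: "nat \<Rightarrow> (nat \<Rightarrow> nat) \<Rightarrow> bool"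
  where "posequence n p \<longleftrightarrow>
    bij_betw p {..<2 ^ n} {..<2 ^ n} \<and>
    \<not> (\<exists>i j. i < j \<and> j < 2 ^ n \<and> sbdom n (p j) (p i))"

definition complies_bdom :: "nat \<Rightarrow> nat set \<Rightarrow> bool"
  where "complies_bdom n A \<longleftrightarrow>
    A \<subseteq> {..<2 ^ n} \<and>
    ((\<forall>j\<in>A. {k. k < 2 ^ n \<and> bdom n k j} \<subseteq> A) \<or>
     (\<forall>j\<in>A. {k. k < 2 ^ n \<and> bdom n j k} \<subseteq> A))"

text \<open>\<open>\<alpha> t i\<close> is the LLR with index \<open>i\<close> at stage \<open>t\<close>. Only the zero pattern is prescribed; the
  nonzero values, which depend on the channel output and on the decoded bits, are arbitrary.\<close>

definition sc_llrs :: "nat \<Rightarrow> nat set \<Rightarrow> (nat \<Rightarrow> nat \<Rightarrow> real) \<Rightarrow> bool"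
  where "sc_llrs n X \<alpha> \<longleftrightarrow>
    (\<forall>i<2 ^ n. \<alpha> n i = 0 \<longleftrightarrow> i \<in> X) \<and>
    (\<forall>t<n. \<forall>i<2 ^ n. \<not> bit i t \<longrightarrow>
      (\<alpha> t i = 0 \<longleftrightarrow> \<alpha> (t + 1) i = 0 \<or> \<alpha> (t + 1) (i + 2 ^ t) = 0)) \<and>
    (\<forall>t<n. \<forall>i<2 ^ n. bit i t \<longrightarrow>
      (\<alpha> t i = 0 \<longleftrightarrow> \<alpha> (t + 1) (i - 2 ^ t) = 0 \<and> \<alpha> (t + 1) i = 0))"

definition incapable_bits :: "nat \<Rightarrow> (nat \<Rightarrow> nat \<Rightarrow> real) \<Rightarrow> nat set"
  where "incapable_bits n \<alpha> = {j. j < 2 ^ n \<and> \<alpha> 0 j = 0}"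

text \<open>Every puncturing bit pattern admits LLRs with the prescribed zero pattern, so the
  hypothesis \<open>sc_llrs n X \<alpha>\<close> is never vacuous.\<close>

primrec zero_pattern :: "nat \<Rightarrow> nat set \<Rightarrow> nat \<Rightarrow> nat \<Rightarrow> bool"
  where
    "zero_pattern n X 0 = (\<lambda>i. i \<in> X)"
  | "zero_pattern n X (Suc k) = (\<lambda>i.
      if bit i (n - Suc k)
      then zero_pattern n X k (i - 2 ^ (n - Suc k)) \<and> zero_pattern n X k i
      else zero_pattern n X k i \<or> zero_pattern n X k (i + 2 ^ (n - Suc k)))"

lemma sc_llrs_exists: "\<exists>\<alpha>. sc_llrs n X \<alpha>"
proof -
  define \<alpha> :: "nat \<Rightarrow> nat \<Rightarrow> real"
    where "\<alpha> = (\<lambda>t i. if zero_pattern n X (n - t) i then 0 else 1)"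
  have "sc_llrs n X \<alpha>"
    unfolding sc_llrs_def
  proof (intro conjI allI impI)
    fix i show "\<alpha> n i = 0 \<longleftrightarrow> i \<in> X" by (simp add: \<alpha>_def)
  next
    fix t i :: nat assume t: "t < n" and b: "\<not> bit i t"
    have "n - t = Suc (n - (t + 1))" and "n - Suc (n - (t + 1)) = t" using t by auto
    then show "\<alpha> t i = 0 \<longleftrightarrow> \<alpha> (t + 1) i = 0 \<or> \<alpha> (t + 1) (i + 2 ^ t) = 0"
      using b by (simp add: \<alpha>_def)
  next
    fix t i :: nat assume t: "t < n" and b: "bit i t"
    have "n - t = Suc (n - (t + 1))" and "n - Suc (n - (t + 1)) = t" using t by auto
    then show "\<alpha> t i = 0 \<longleftrightarrow> \<alpha> (t + 1) (i - 2 ^ t) = 0 \<and> \<alpha> (t + 1) i = 0"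
      using b by (simp add: \<alpha>_def)
  qed
  then show ?thesis by blast
qed

definition reverse_puncturing :: "nat \<Rightarrow> nat set \<Rightarrow> nat set \<Rightarrow> bool"
  where "reverse_puncturing n X U \<longleftrightarrow> U = bcompl n ` X"

end

theory Submission
  imports Defs
begin

text \<open>A suffix of a posequence is an up-set for binary domination. When the decoder combines
  \<open>i\<close> and \<open>i + 2 ^ t\<close> with an up-set as zero pattern, ``one of both vanishes'' is decided by the
  larger index and ``both vanish'' by the smaller one. So stage \<open>t\<close> merely flips digit \<open>t\<close>, and
  the zero pattern remains an up-set in the digits not yet treated; after all stages every digit
  is flipped, which is the bitwise complement.\<close>

text \<open>Write \<open>j = p b\<close> and \<open>k = p a\<close>. If \<open>a < b\<close>,
  domination of \<open>p b\<close> by \<open>p a\<close> would be strict by injectivity, which a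
  posequence forbids. Hence \<open>m \<le> b \<le> a\<close>, and \<open>k\<close> lies in the
  suffix too.\<close>

lemma posequence_suffix_up_closed:
  assumes "posequence n p" and "j \<in> p ` {m..<2 ^ n}" and "k < 2 ^ n" and "bdom n j k"
  shows "k \<in> p ` {m..<2 ^ n}"
proof -
  obtain b where b: "b \<in> {m..<2 ^ n}" "j = p b" using assms(2) by blast
  have "k \<in> p ` {..<2 ^ n}" using assms(1,3) by (auto simp: posequence_def bij_betw_def)
  then obtain a where a: "a < 2 ^ n" "k = p a" by auto
  have "b \<le> a"
  proof (rule ccontr)
    assume "\<not> b \<le> a"
    then have "a < b" "b < 2 ^ n" using b by auto
    then have "\<not> sbdom n (p b) (p a)" using assms(1) by (auto simp: posequence_def)
    then have "p b = p a" using assms(4) a b by (auto simp: sbdom_def)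
    moreover have "inj_on p {..<2 ^ n}" using assms(1) by (simp add: posequence_def bij_betw_def)
    ultimately have "b = a" using a b by (auto dest: inj_onD)
    with \<open>a < b\<close> show False by simp
  qed
  with a b show ?thesis by auto
qed

lemma xor_less_exp:
  includes bit_operations_syntax
  fixes a b :: nat
  assumes "a < 2 ^ n" and "b < 2 ^ n"
  shows "a XOR b < 2 ^ n"
proof -
  have "take_bit n (a XOR b) = a XOR b"
    using assms by (simp add: take_bit_nat_eq_self)
  then show ?thesis by (metis take_bit_nat_less_exp)
qed

lemma push_bit_mask_less_exp: "push_bit t (mask (n - t) :: nat) < 2 ^ n"
proof -
  have "take_bit n (push_bit t (mask (n - t) :: nat)) = push_bit t (mask (n - t))"
    by (rule bit_eqI) (auto simp: bit_take_bit_iff bit_push_bit_iff bit_mask_iff)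
  then show ?thesis by (metis take_bit_nat_less_exp)
qed

text \<open>The number \<open>push_bit t (mask (n - t))\<close> has ones exactly at the digits from
  \<open>t\<close> to \<open>n - 1\<close>, those already processed at stage \<open>t\<close>. It is
  0 at \<open>t = n\<close>, where the downward induction starts, and the full mask at
  \<open>t = 0\<close>.\<close>

lemma sc_zero_iff:
  includes bit_operations_syntax
  assumes sc: "sc_llrs n X \<alpha>"
    and up: "\<And>j k. j \<in> X \<Longrightarrow> k < 2 ^ n \<Longrightarrow> bdom n j k \<Longrightarrow> k \<in> X"
    and "t \<le> n" and "i < 2 ^ n"
  shows "\<alpha> t i = 0 \<longleftrightarrow> i XOR push_bit t (mask (n - t)) \<in> X"
  using assms(3,4)
proof (induction t arbitrary: i rule: inc_induct)
  case base
  then show ?case using sc by (simp add: sc_llrs_def)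
next
  case (step t)
  \<comment> \<open>\<open>f s\<close> flips the digits from \<open>s\<close> to
    \<open>n - 1\<close>; \<open>bf\<close> reduces every later claim about it to single
    digits.\<close>
  define f :: "nat \<Rightarrow> nat \<Rightarrow> nat" where "f s i = i XOR push_bit s (mask (n - s))" for s i
  have bf: "bit (f s i) b \<longleftrightarrow> (bit i b \<noteq> (s \<le> b \<and> b < n))" for s i b
    by (auto simp: f_def bit_xor_iff bit_push_bit_iff bit_mask_iff)
  have lt: "f s j < 2 ^ n" if "j < 2 ^ n" for s j
    unfolding f_def using that push_bit_mask_less_exp by (rule xor_less_exp)
  have IH: "\<alpha> (Suc t) j = 0 \<longleftrightarrow> f (Suc t) j \<in> X" if "j < 2 ^ n" for j
    using step.IH that by (simp add: f_def)
  show ?case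
  proof (cases "bit i t")
    case True
    have eq: "i - 2 ^ t = unset_bit t i"
    proof -
      have "i = set_bit t (unset_bit t i)"
        using True by (intro bit_eqI) (auto simp: bit_simps)
      then have "i = unset_bit t i + 2 ^ t"
        by (simp add: set_bit_eq bit_unset_bit_iff)
      then show ?thesis by simp
    qed
    have j: "i - 2 ^ t < 2 ^ n" using step.prems by simp
    \<comment> \<open>Clearing digit \<open>t\<close> is the same as flipping it, since it is set in
      \<open>i\<close>.\<close>
    have f: "f (Suc t) (i - 2 ^ t) = f t i"
      using True step.hyps by (intro bit_eqI) (auto simp: eq bf bit_unset_bit_iff Suc_le_eq le_less)
    \<comment> \<open>The two numbers differ only in digit \<open>t\<close>, which is 0 in
      \<open>f t i\<close> and 1 in \<open>f (Suc t) i\<close>. The conjunction thus reduces to its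
      first member.\<close>
    have "f t i \<in> X \<Longrightarrow> f (Suc t) i \<in> X"
      using True by (rule_tac up[OF _ lt[OF step.prems]]) (auto simp: bdom_def bf Suc_le_eq le_less)
    moreover have "\<alpha> t i = 0 \<longleftrightarrow> \<alpha> (Suc t) (i - 2 ^ t) = 0 \<and> \<alpha> (Suc t) i = 0"
      using sc step True by (simp add: sc_llrs_def)
    ultimately show ?thesis
      using IH[OF j] IH[OF step.prems] f by (auto simp: f_def)
  next
    case False
    have eq: "i + 2 ^ t = set_bit t i"
      using False by (simp add: set_bit_eq)
    \<comment> \<open>Adding \<open>2 ^ t\<close> produces no carry, and \<open>t < n\<close>, so no
      digit from \<open>n\<close> on appears.\<close>
    have j: "i + 2 ^ t < 2 ^ n"
    proof -
      have "take_bit n (set_bit t i) = set_bit t i"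
        using step by (simp add: take_bit_set_bit_eq take_bit_nat_eq_self)
      then show ?thesis unfolding eq by (metis take_bit_nat_less_exp)
    qed
    have f: "f (Suc t) (i + 2 ^ t) = f t i"
      using False step.hyps by (intro bit_eqI) (auto simp: eq bf bit_set_bit_iff Suc_le_eq le_less)
    \<comment> \<open>Now digit \<open>t\<close> is 0 in \<open>f (Suc t) i\<close> and 1 in
      \<open>f t i\<close>, so the first disjunct implies the second.\<close>
    have "f (Suc t) i \<in> X \<Longrightarrow> f t i \<in> X"
      using False by (rule_tac up[OF _ lt[OF step.prems]]) (auto simp: bdom_def bf Suc_le_eq le_less)
    moreover have "\<alpha> t i = 0 \<longleftrightarrow> \<alpha> (Suc t) i = 0 \<or> \<alpha> (Suc t) (i + 2 ^ t) = 0"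
      using sc step False by (simp add: sc_llrs_def)
    ultimately show ?thesis
      using IH[OF j] IH[OF step.prems] f by (auto simp: f_def)
  qed
qed

text \<open>\<open>i\<close> and \<open>i XOR mask n\<close> share no set digit, so they add without
  carries and their sum is \<open>mask n\<close>, that is, \<open>2 ^ n - 1\<close>.\<close>

lemma bcompl_eq_xor_mask:
  includes bit_operations_syntax
  assumes "i < 2 ^ n"
  shows "bcompl n i = i XOR mask n"
proof -
  have "take_bit n i = i" using assms by (simp add: take_bit_nat_eq_self)
  then have "bit i b \<Longrightarrow> b < n" for b by (metis bit_take_bit_iff)
  then have "i AND (i XOR mask n) = 0"
    by (intro bit_eqI) (auto simp: bit_and_iff bit_xor_iff bit_mask_iff)
  then have "i + (i XOR mask n) = i XOR (i XOR mask n)"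
    by (rule disjunctive_add_eq_xor)
  also have "\<dots> = 2 ^ n - 1"
    by (simp add: mask_eq_exp_minus_1 flip: xor.assoc)
  finally show ?thesis by (simp add: bcompl_def)
qed

theorem theorem16:
  fixes n J :: nat and p :: "nat \<Rightarrow> nat" and Xp Up :: "nat set" and \<alpha> :: "nat \<Rightarrow> nat \<Rightarrow> real"
  assumes "n \<ge> 1"
    and "1 \<le> J" and "J < 2 ^ n"
    and "posequence n p"
    and "Xp = p ` {2 ^ n - J..<2 ^ n}"
    and "sc_llrs n Xp \<alpha>"
    and "Up = incapable_bits n \<alpha>"
  shows "complies_bdom n Xp \<and> reverse_puncturing n Xp Up"
proof -
  have up: "k \<in> Xp" if "j \<in> Xp" "k < 2 ^ n" "bdom n j k" for j k
    using posequence_suffix_up_closed[OF assms(4)] that unfolding assms(5) by blast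
  have sub: "Xp \<subseteq> {..<2 ^ n}"
    using assms(4) by (auto simp: assms(5) posequence_def bij_betw_def)
  have inv: "bcompl n i < 2 ^ n" "bcompl n (bcompl n i) = i" if "i < 2 ^ n" for i
    using that by (auto simp: bcompl_def)
  have "\<alpha> 0 i = 0 \<longleftrightarrow> bcompl n i \<in> Xp" if "i < 2 ^ n" for i
    using sc_zero_iff[OF assms(6) up, where t = 0 and i = i] that by (simp add: bcompl_eq_xor_mask)
  then have "Up = {i. i < 2 ^ n \<and> bcompl n i \<in> Xp}"
    by (auto simp: assms(7) incapable_bits_def)
  \<comment> \<open>The complement is an involution on the indices below \<open>2 ^ n\<close>, so
    preimage and image of \<open>Xp\<close> agree.\<close>
  also have "\<dots> = bcompl n ` Xp"
  proof (intro equalityI subsetI)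
    fix i assume "i \<in> {i. i < 2 ^ n \<and> bcompl n i \<in> Xp}"
    then show "i \<in> bcompl n ` Xp" using inv(2)[of i] by (auto intro: rev_image_eqI)
  next
    fix i assume "i \<in> bcompl n ` Xp"
    then obtain x where x: "x \<in> Xp" "i = bcompl n x" by blast
    with sub have "x < 2 ^ n" by auto
    with x show "i \<in> {i. i < 2 ^ n \<and> bcompl n i \<in> Xp}" by (simp add: inv)
  qed
  finally show ?thesis
    using sub up by (auto simp: complies_bdom_def reverse_puncturing_def)
qed

end
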